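(* Let $(Q,I)$ be a gentle bound quiver with $I=\langle Z\rangle$ a quadratic monomial ideal, let $k\in Q_0$, and let $Q'=\mu_k(Q)$. Let $I'=\langle \beta\alpha\mid(\alpha,\beta)\in Z'\rangle\subseteq \Bbbk Q'$ be any ideal produced by the admissibility mutation construction, i.e. $Z'=\mathcal C(Q')\setminus P$ for some $P\subseteq P_{\mathrm{pref}}\subseteq \mathcal C(Q')\setminus Z_{\mathrm{for}}$ such that the directed graph with vertex set $Q'_1$ and arrows $\alpha\to\beta$ for $(\alpha,\beta)\in P$ has no oriented cycle. Then $I'$ is admissible.
   Context: $\Bbbk$ is a field of characteristic zero. A quiver $Q$ is a finite directed graph with vertices $Q_0$, arrows $Q_1$, source/target maps $s,t$. All quivers are finite cluster quivers (no loops, no oriented 2-cycles). In the path algebra $\Bbbk Q$, $\beta\alpha$ denotes $\alpha$ followed by $\beta$ (defined when $t(\alpha)=s(\beta)$). $\mathfrak r_Q$ is the ideal generated by the arrows; an ideal $I$ is admissible if $\mathfrak r_Q^m\subseteq I\subseteq\mathfrak r_Q^2$ for some integer $m\ge2$, and then $(Q,I)$ is a bound quiver. $(Q,I)$ (or $\Bbbk Q/I$) is gentle if $I$ is admissible and: (G1) each vertex has at most two incoming and at most two outgoing arrows; (G2) for every arrow $\alpha$ there is at most one arrow $\beta$ with $\beta\alpha$ composable and $\beta\alpha\notin I$, and at most one arrow $\gamma$ with $\alpha\gamma$ composable and $\alpha\gamma\notin I$; (G3) $I$ is generated by paths of length two; (G4) for every arrow $\alpha$ there is at most one arrow $\beta$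 with $\beta\alpha$ composable and $\beta\alpha\in I$, and at most one arrow $\gamma$ with $\alpha\gamma$ composable and $\alpha\gamma\in I$. Quiver mutation $\mu_k(Q)$: (1) for every oriented path $i\to k\to j$ add an arrow $i\to j$; (2) reverse all arrows incident with $k$; (3) cancel all oriented 2-cycles. Admissibility mutation construction. Let $\mathcal C(Q')=\{(\alpha,\beta)\in Q'_1\times Q'_1\mid t(\alpha)=s(\beta)\}$; the pair $(\alpha,\beta)$ stands for the path $\beta\alpha$. For each path $i\xrightarrow{\alpha_i}k\xrightarrow{\beta_j}j$ in $Q$ let $\eta_{ij}:i\to j$ be the corresponding composite arrow of $Q'$ if it survives 2-cycle cancellation, and let $\alpha_i^*:k\to i$, $\beta_j^*:j\to k$ be the reversed arrows. "Initial arrows surviving in $Q'$" are arrows of $Q$ not incident with $k$ and not removed by cancellation. The forced zero-relations $Z_{\mathrm{for}}\subseteq\mathcal C(Q')$ are the following pairs: (a) $(\alpha,\beta)$ with $\alpha,\beta$ surviving initial arrows and $\beta\alpha\in I$; (b) relations of $I$ involving an initial arrow removed by cancellation are dropped (they contribute nothing); (c) for a composite arrow $\eta_{ij}$ of $Q'$: $(\rho,\eta_{ij})$ for each surviving initial arrow $\rho:h\to i$ with $\alpha_i\rho\in I$, and $(\eta_{ij},\tau)$ for each surviving initial arrow $\tau:j\to\ell$ with $\tau\beta_j\in I$; (d) $(\beta_j^*,\alpha_i^* )$ for each path $i\xrightarrow{\alpha_i}k\xrightarrow{\beta_j}j$ in $Q$ with $\beta_j\alpha_i\notin I$. Next one chooses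 a set $P_{\mathrm{pref}}\subseteq\mathcal C(Q')\setminus Z_{\mathrm{for}}$ of preferred permitted transitions (composable pairs one would like to keep nonzero, for example initial permitted paths away from the mutation neighbourhood, transported permitted paths involving composite arrows, and reversed paths through $k$ coming from initial zero-relations through $k$). Then one chooses a subset $P\subseteq P_{\mathrm{pref}}$ whose directed graph on $Q'_1$ has no oriented cycle (for instance $P=P_{\mathrm{pref}}$ if that is already acyclic, or only the pairs $(\alpha,\beta)\in P_{\mathrm{pref}}$ with $\alpha\prec\beta$ for a total order $\prec$ on $Q'_1$, or $P_{\mathrm{pref}}$ minus a set of edges meeting every oriented cycle). Finally $Z'=\mathcal C(Q')\setminus P$ and $I'=\langle\beta\alpha\mid(\alpha,\beta)\in Z'\rangle$. *)

theory Defs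
  imports
    "Graph_Theory.Arc_Walk"
    "HOL-Library.Poly_Mapping"
    "HOL-Library.Disjoint_Sets"
    "HOL-Algebra.Ideal_Product"
begin

section \<open>Quivers\<close>

definition two_cycle :: "('v, 'e) pre_digraph \<Rightarrow> 'e \<Rightarrow> 'e \<Rightarrow> bool" where
  "two_cycle Q a b \<longleftrightarrow>
     a \<in> arcs Q \<and> b \<in> arcs Q \<and> head Q a = tail Q b \<and> head Q b = tail Q a"

text \<open>Parallel arrows are allowed, hence not \<^locale>\<open>digraph\<close>.\<close>

locale cluster_quiver = fin_digraph Q + loopfree_digraph Q for Q :: "('v, 'e) pre_digraph" +
  assumes no_two_cycles: "\<not> two_cycle Q a b"

text \<open>A pair \<open>(\<alpha>, \<beta>)\<close> stands for the path \<open>\<beta>\<alpha>\<close>, that is, \<open>\<alpha>\<close> followed by \<open>\<beta>\<close>.\<close>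

definition composable_pairs :: "('v, 'e) pre_digraph \<Rightarrow> ('e \<times> 'e) set" where
  "composable_pairs Q = {(a, b). a \<in> arcs Q \<and> b \<in> arcs Q \<and> head Q a = tail Q b}"


section \<open>Path algebras\<close>

text \<open>
  A path is given by its starting vertex and the list of its arrows in the order in which they are
  traversed; the trivial path at \<open>v\<close> is \<open>(v, [])\<close>.
\<close>

type_synonym ('v, 'e) path = "'v \<times> 'e list"

definition paths :: "('v, 'e) pre_digraph \<Rightarrow> ('v, 'e) path set" where
  "paths Q = {(u, p). \<exists>v. pre_digraph.awalk Q u p v}"

definition path_end :: "('v, 'e) pre_digraph \<Rightarrow> ('v, 'e) path \<Rightarrow> 'v" where
  "path_end Q p = last (pre_digraph.awalk_verts Q (fst p) (snd p))"

text \<open>In a product \<open>p q\<close> of paths, \<open>q\<close> is traversed first.\<close>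

definition path_mult ::
  "('v, 'e) pre_digraph \<Rightarrow> (('v, 'e) path \<Rightarrow>\<^sub>0 'f::field) \<Rightarrow> (('v, 'e) path \<Rightarrow>\<^sub>0 'f) \<Rightarrow> (('v, 'e) path \<Rightarrow>\<^sub>0 'f)"
where
  "path_mult Q x y =
     (\<Sum>p\<in>Poly_Mapping.keys x. \<Sum>q\<in>Poly_Mapping.keys y.
        if path_end Q q = fst p
        then Poly_Mapping.single (fst q, snd q @ snd p)
               (Poly_Mapping.lookup x p * Poly_Mapping.lookup y q)
        else 0)"

definition path_algebra :: "('v, 'e) pre_digraph \<Rightarrow> (('v, 'e) path \<Rightarrow>\<^sub>0 'f::field) ring" where
  "path_algebra Q =
     \<lparr>carrier = {x. Poly_Mapping.keys x \<subseteq> paths Q},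
      mult = path_mult Q,
      one = (\<Sum>v\<in>verts Q. Poly_Mapping.single (v, []) 1),
      zero = 0,
      add = (+)\<rparr>"

definition arrow :: "('v, 'e) pre_digraph \<Rightarrow> 'e \<Rightarrow> (('v, 'e) path \<Rightarrow>\<^sub>0 'f::field)" where
  "arrow Q a = Poly_Mapping.single (tail Q a, [a]) 1"

definition pair_path :: "('v, 'e) pre_digraph \<Rightarrow> 'e \<times> 'e \<Rightarrow> (('v, 'e) path \<Rightarrow>\<^sub>0 'f::field)" where
  "pair_path Q = (\<lambda>(a, b). arrow Q b \<otimes>\<^bsub>path_algebra Q\<^esub> arrow Q a)"

definition pair_ideal :: "('v, 'e) pre_digraph \<Rightarrow> ('e \<times> 'e) set \<Rightarrow> (('v, 'e) path \<Rightarrow>\<^sub>0 'f::field) set" where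
  "pair_ideal Q Z = Idl\<^bsub>path_algebra Q\<^esub> (pair_path Q ` Z)"

definition arrow_ideal :: "('v, 'e) pre_digraph \<Rightarrow> (('v, 'e) path \<Rightarrow>\<^sub>0 'f::field) set" where
  "arrow_ideal Q = Idl\<^bsub>path_algebra Q\<^esub> (arrow Q ` arcs Q)"

text \<open>Powers of an ideal are powers in the semiring \<^const>\<open>ideals_set\<close> of ideals.\<close>

definition admissible :: "('v, 'e) pre_digraph \<Rightarrow> (('v, 'e) path \<Rightarrow>\<^sub>0 'f::field) set \<Rightarrow> bool" where
  "admissible Q I \<longleftrightarrow>
     ideal I (path_algebra Q) \<and>
     (\<exists>m::nat. m \<ge> 2 \<and>
        arrow_ideal Q [^]\<^bsub>ideals_set (path_algebra Q)\<^esub> m \<subseteq> I \<and>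
        I \<subseteq> arrow_ideal Q [^]\<^bsub>ideals_set (path_algebra Q)\<^esub> (2::nat))"

definition gentle :: "('v, 'e) pre_digraph \<Rightarrow> (('v, 'e) path \<Rightarrow>\<^sub>0 'f::field) set \<Rightarrow> bool" where
  "gentle Q I \<longleftrightarrow>
     admissible Q I \<and>
     (\<forall>v\<in>verts Q. card {a \<in> arcs Q. head Q a = v} \<le> 2 \<and> card {a \<in> arcs Q. tail Q a = v} \<le> 2) \<and>
     (\<forall>a\<in>arcs Q.
        (\<exists>\<^sub>\<le>\<^sub>1b. (a, b) \<in> composable_pairs Q \<and> pair_path Q (a, b) \<notin> I) \<and>
        (\<exists>\<^sub>\<le>\<^sub>1c. (c, a) \<in> composable_pairs Q \<and> pair_path Q (c, a) \<notin> I)) \<and>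
     (\<exists>Z \<subseteq> composable_pairs Q. I = pair_ideal Q Z) \<and>
     (\<forall>a\<in>arcs Q.
        (\<exists>\<^sub>\<le>\<^sub>1b. (a, b) \<in> composable_pairs Q \<and> pair_path Q (a, b) \<in> I) \<and>
        (\<exists>\<^sub>\<le>\<^sub>1c. (c, a) \<in> composable_pairs Q \<and> pair_path Q (c, a) \<in> I))"


section \<open>Quiver mutation\<close>

text \<open>
  Arrows of a mutated quiver: \<open>Init \<alpha>\<close> is an arrow \<open>\<alpha>\<close> of the initial quiver not incident with the
  mutation vertex \<open>k\<close>, \<open>Comp \<alpha> \<beta>\<close> is the composite arrow \<open>i \<rightarrow> j\<close> of a path \<open>\<alpha> : i \<rightarrow> k\<close>,
  \<open>\<beta> : k \<rightarrow> j\<close>, and \<open>Rev \<alpha>\<close> is the reversal of an arrow incident with \<open>k\<close>.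
\<close>

datatype 'e mut_arrow = Init 'e | Comp 'e 'e | Rev 'e

fun mut_tail :: "('v, 'e) pre_digraph \<Rightarrow> 'e mut_arrow \<Rightarrow> 'v" where
  "mut_tail Q (Init a) = tail Q a"
| "mut_tail Q (Comp a b) = tail Q a"
| "mut_tail Q (Rev a) = head Q a"

fun mut_head :: "('v, 'e) pre_digraph \<Rightarrow> 'e mut_arrow \<Rightarrow> 'v" where
  "mut_head Q (Init a) = head Q a"
| "mut_head Q (Comp a b) = head Q b"
| "mut_head Q (Rev a) = tail Q a"

definition paths_through :: "('v, 'e) pre_digraph \<Rightarrow> 'v \<Rightarrow> ('e \<times> 'e) set" where
  "paths_through Q k = {(a, b) \<in> composable_pairs Q. head Q a = k}"

text \<open>The result of the first two mutation steps, before cancellation.\<close>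

definition premutation :: "('v, 'e) pre_digraph \<Rightarrow> 'v \<Rightarrow> ('v, 'e mut_arrow) pre_digraph" where
  "premutation Q k =
     \<lparr>verts = verts Q,
      arcs = {Init a |a. a \<in> arcs Q \<and> tail Q a \<noteq> k \<and> head Q a \<noteq> k}
           \<union> {Comp a b |a b. (a, b) \<in> paths_through Q k}
           \<union> {Rev a |a. a \<in> arcs Q \<and> (tail Q a = k \<or> head Q a = k)},
      tail = mut_tail Q,
      head = mut_head Q\<rparr>"

text \<open>
  Cancellation removes pairwise disjoint 2-cycles until none is left. In the presence of parallel
  arrows the choice of the 2-cycles determines which arrows survive, so mutation is a relation.
\<close>

definition is_mutation :: "('v, 'e) pre_digraph \<Rightarrow> 'v \<Rightarrow> ('v, 'e mut_arrow) pre_digraph \<Rightarrow> bool" where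
  "is_mutation Q k Q' \<longleftrightarrow>
     (\<exists>M. M \<subseteq> {{a, b} |a b. two_cycle (premutation Q k) a b} \<and> disjoint M \<and>
        Q' = (premutation Q k)\<lparr>arcs := arcs (premutation Q k) - \<Union>M\<rparr> \<and>
        (\<forall>a b. \<not> two_cycle Q' a b))"


section \<open>Forced zero-relations\<close>

text \<open>
  Relations of \<open>I\<close> involving a cancelled initial arrow contribute nothing: every arrow below is
  required to be an arrow of \<open>Q'\<close>, except for reversed arrows, which are never cancelled.
\<close>

definition forced_relations ::
  "('v, 'e) pre_digraph \<Rightarrow> (('v, 'e) path \<Rightarrow>\<^sub>0 'f::field) set \<Rightarrow> 'v \<Rightarrow> ('v, 'e mut_arrow) pre_digraph
     \<Rightarrow> ('e mut_arrow \<times> 'e mut_arrow) set"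
where
  "forced_relations Q I k Q' =
     {(Init a, Init b) |a b. Init a \<in> arcs Q' \<and> Init b \<in> arcs Q' \<and>
        (a, b) \<in> composable_pairs Q \<and> pair_path Q (a, b) \<in> I}
   \<union> {(Init r, Comp a b) |r a b. Init r \<in> arcs Q' \<and> Comp a b \<in> arcs Q' \<and>
        (r, a) \<in> composable_pairs Q \<and> pair_path Q (r, a) \<in> I}
   \<union> {(Comp a b, Init t) |a b t. Comp a b \<in> arcs Q' \<and> Init t \<in> arcs Q' \<and>
        (b, t) \<in> composable_pairs Q \<and> pair_path Q (b, t) \<in> I}
   \<union> {(Rev b, Rev a) |a b. (a, b) \<in> paths_through Q k \<and> pair_path Q (a, b) \<notin> I}"


section \<open>Basic facts\<close>

lemma path_mult_superset:
  assumes "finite A" "Poly_Mapping.keys x \<subseteq> A" "finite B" "Poly_Mapping.keys y \<subseteq> B"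
  shows "path_mult Q x y =
     (\<Sum>p\<in>A. \<Sum>q\<in>B.
        if path_end Q q = fst p
        then Poly_Mapping.single (fst q, snd q @ snd p)
               (Poly_Mapping.lookup x p * Poly_Mapping.lookup y q)
        else 0)"
    (is "_ = (\<Sum>p\<in>A. \<Sum>q\<in>B. ?f p q)")
proof -
  have "path_mult Q x y = (\<Sum>p\<in>Poly_Mapping.keys x. \<Sum>q\<in>B. ?f p q)"
    unfolding path_mult_def
    by (rule sum.cong[OF refl], rule sum.mono_neutral_left) (use assms in \<open>auto simp: in_keys_iff\<close>)
  also have "\<dots> = (\<Sum>p\<in>A. \<Sum>q\<in>B. ?f p q)"
    by (rule sum.mono_neutral_left) (use assms in \<open>auto simp: in_keys_iff intro!: sum.neutral\<close>)
  finally show ?thesis .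
qed

lemma path_mult_zero [simp]: "path_mult Q 0 y = 0" "path_mult Q x 0 = 0"
  by (simp_all add: path_mult_def)

lemma path_mult_add_left: "path_mult Q (x + x') y = path_mult Q x y + path_mult Q x' y"
proof -
  let ?A = "Poly_Mapping.keys x \<union> Poly_Mapping.keys x'"
  note superset = path_mult_superset[of ?A _ "Poly_Mapping.keys y" y Q]
  show ?thesis
    unfolding superset[of "x + x'", simplified, OF Poly_Mapping.keys_add]
      superset[of x, simplified] superset[of x', simplified] sum.distrib[symmetric]
    by (intro sum.cong refl) (simp add: lookup_add single_add distrib_right)
qed

lemma path_mult_add_right: "path_mult Q x (y + y') = path_mult Q x y + path_mult Q x y'"
proof -
  let ?A = "Poly_Mapping.keys y \<union> Poly_Mapping.keys y'"
  note superset = path_mult_superset[of "Poly_Mapping.keys x" x ?A _ Q]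
  show ?thesis
    unfolding superset[of "y + y'", simplified, OF Poly_Mapping.keys_add]
      superset[of y, simplified] superset[of y', simplified] sum.distrib[symmetric]
    by (intro sum.cong refl) (simp add: lookup_add single_add distrib_left)
qed

lemma path_mult_single:
  "path_mult Q (Poly_Mapping.single p c) (Poly_Mapping.single q d) =
     (if path_end Q q = fst p then Poly_Mapping.single (fst q, snd q @ snd p) (c * d) else 0)"
  by (subst path_mult_superset[of "{p}" _ "{q}"]) auto

lemma path_mult_sum_left: "path_mult Q (sum f A) y = (\<Sum>a\<in>A. path_mult Q (f a) y)"
  by (induction A rule: infinite_finite_induct) (auto simp: path_mult_add_left)

lemma path_mult_sum_right: "path_mult Q x (sum f A) = (\<Sum>a\<in>A. path_mult Q x (f a))"
  by (induction A rule: infinite_finite_induct) (auto simp: path_mult_add_right)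

lemma path_end_alt:
  "path_end Q p = (if snd p = [] then fst p else head Q (last (snd p)))"
  by (auto simp: path_end_def pre_digraph.awalk_verts_conv)

lemma path_end_append: "path_end Q (u, q @ p) = path_end Q (path_end Q (u, q), p)"
  by (simp add: path_end_alt)

lemma sum_single_eq: "x = (\<Sum>p\<in>Poly_Mapping.keys x. Poly_Mapping.single p (Poly_Mapping.lookup x p))"
  by (rule poly_mapping_eqI) (auto simp: lookup_sum lookup_single when_def in_keys_iff)

lemma path_mult_assoc: "path_mult Q (path_mult Q x y) z = path_mult Q x (path_mult Q y z)"
proof -
  have single: "path_mult Q (path_mult Q (Poly_Mapping.single p c) (Poly_Mapping.single q d))
        (Poly_Mapping.single r e) =
      path_mult Q (Poly_Mapping.single p c) (path_mult Q (Poly_Mapping.single q d)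
        (Poly_Mapping.single r e))" for p q r c d e
    by (cases p; cases q; cases r) (auto simp: path_mult_single path_end_append mult.assoc)
  show ?thesis
    by (subst (1 2) sum_single_eq[of x], subst (1 2) sum_single_eq[of y],
        subst (1 2) sum_single_eq[of z])
      (simp add: path_mult_sum_left path_mult_sum_right single)
qed

lemma paths_append:
  assumes "wf_digraph Q" "p \<in> paths Q" "q \<in> paths Q" "path_end Q q = fst p"
  shows "(fst q, snd q @ snd p) \<in> paths Q"
proof -
  interpret wf_digraph Q by fact
  show ?thesis
    using assms(2-4)
    by (cases p; cases q) (auto simp: paths_def path_end_def intro!: awalk_appendI exI)
qed

lemma path_mult_closed:
  assumes "wf_digraph Q" "Poly_Mapping.keys x \<subseteq> paths Q" "Poly_Mapping.keys y \<subseteq> paths Q"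
  shows "Poly_Mapping.keys (path_mult Q x y) \<subseteq> paths Q"
  unfolding path_mult_def
  using assms
  by (intro order.trans[OF Poly_Mapping.keys_sum] UN_least)
    (auto dest!: paths_append[OF assms(1)])

lemma path_mult_one:
  fixes x :: "('v, 'e) path \<Rightarrow>\<^sub>0 'f::field"
  assumes "fin_digraph Q" "Poly_Mapping.keys x \<subseteq> paths Q"
  shows "path_mult Q (\<Sum>v\<in>verts Q. Poly_Mapping.single (v, []) 1) x = x"
    and "path_mult Q x (\<Sum>v\<in>verts Q. Poly_Mapping.single (v, []) 1) = x"
proof -
  interpret fin_digraph Q by fact
  have *: "fst p \<in> verts Q \<and> path_end Q p \<in> verts Q" if "p \<in> Poly_Mapping.keys x" for p
    using subsetD[OF assms(2) that]
    by (cases p) (auto simp: paths_def path_end_def dest: awalk_hd_in_verts awalk_last_in_verts)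
  have single: "path_mult Q (\<Sum>v\<in>verts Q. Poly_Mapping.single (v, []) 1) (Poly_Mapping.single p c) =
      Poly_Mapping.single p c"
    "path_mult Q (Poly_Mapping.single p c) (\<Sum>v\<in>verts Q. Poly_Mapping.single (v, []) 1) =
      Poly_Mapping.single p c" if "p \<in> Poly_Mapping.keys x" for p and c :: 'f
    using *[OF that]
    by (simp_all add: path_mult_sum_left path_mult_sum_right path_mult_single
        path_end_alt[of _ "(_, [])"] sum.delta cong: if_cong)
  show "path_mult Q (\<Sum>v\<in>verts Q. Poly_Mapping.single (v, []) 1) x = x"
    by (subst (1 2) sum_single_eq[of x]) (simp only: path_mult_sum_right single cong: sum.cong)
  show "path_mult Q x (\<Sum>v\<in>verts Q. Poly_Mapping.single (v, []) 1) = x"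
    by (subst (1 2) sum_single_eq[of x])
      (subst path_mult_sum_left, simp only: single cong: sum.cong)
qed

theorem ring_path_algebra:
  fixes Q :: "('v, 'e) pre_digraph"
  assumes "fin_digraph Q"
  shows "ring (path_algebra Q :: (('v, 'e) path \<Rightarrow>\<^sub>0 'f::field) ring)"
proof -
  interpret fin_digraph Q by fact
  show ?thesis
  proof (rule ringI)
    show "abelian_group (path_algebra Q :: (('v, 'e) path \<Rightarrow>\<^sub>0 'f) ring)"
    proof (rule abelian_groupI)
      fix x :: "('v, 'e) path \<Rightarrow>\<^sub>0 'f" assume "x \<in> carrier (path_algebra Q)"
      then show "\<exists>y\<in>carrier (path_algebra Q). y \<oplus>\<^bsub>path_algebra Q\<^esub> x = \<zero>\<^bsub>path_algebra Q\<^esub>"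
        by (intro bexI[of _ "- x"]) (auto simp: path_algebra_def)
    qed (use Poly_Mapping.keys_add in \<open>fastforce simp: path_algebra_def add_ac\<close>)+
    have "Poly_Mapping.keys (\<Sum>v\<in>verts Q. Poly_Mapping.single (v, [] :: 'e list) (1 :: 'f))
      \<subseteq> paths Q"
      by (intro order.trans[OF Poly_Mapping.keys_sum] UN_least) (auto simp: paths_def awalk_Nil_iff)
    then show "monoid (path_algebra Q :: (('v, 'e) path \<Rightarrow>\<^sub>0 'f) ring)"
      using path_mult_closed[OF wf_digraph_axioms] path_mult_one[OF fin_digraph_axioms]
      by (intro monoidI) (simp_all add: path_algebra_def path_mult_assoc)
  qed (simp_all add: path_algebra_def path_mult_add_left path_mult_add_right)
qed

lemma pair_path_eq:
  "(a, b) \<in> composable_pairs Q \<Longrightarrow> pair_path Q (a, b) = Poly_Mapping.single (tail Q a, [a, b]) 1"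
  by (simp add: pair_path_def path_algebra_def arrow_def path_mult_single path_end_alt
      composable_pairs_def)

lemma finite_arcs_premutation:
  assumes "fin_digraph Q"
  shows "finite (arcs (premutation Q k))"
proof (rule finite_subset)
  show "arcs (premutation Q k) \<subseteq>
    Init ` arcs Q \<union> case_prod Comp ` (arcs Q \<times> arcs Q) \<union> Rev ` arcs Q"
    by (auto simp: premutation_def paths_through_def composable_pairs_def)
qed (use fin_digraph.finite_arcs[OF assms] in auto)

lemma ex_is_mutation:
  assumes "fin_digraph Q"
  shows "\<exists>Q'. is_mutation Q k Q'"
proof -
  let ?R = "premutation Q k"
  let ?C = "{{a, b} |a b. two_cycle ?R a b}"
  have "?C \<subseteq> Pow (arcs ?R)"
    by (auto simp: two_cycle_def)
  then have "finite ?C"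
    by (rule finite_subset) (simp add: finite_arcs_premutation[OF assms])
  then have "finite {M \<in> Pow ?C. disjoint M}"
    by simp
  moreover have "{} \<in> {M \<in> Pow ?C. disjoint M}"
    by simp
  ultimately have "\<exists>M\<in>{M \<in> Pow ?C. disjoint M}. {} \<subseteq> M \<and>
      (\<forall>N\<in>{M \<in> Pow ?C. disjoint M}. M \<subseteq> N \<longrightarrow> M = N)"
    by (rule finite_has_maximal2)
  then obtain M where M_in: "M \<in> {M \<in> Pow ?C. disjoint M}"
    and M_max: "{} \<subseteq> M \<and> (\<forall>N\<in>{M \<in> Pow ?C. disjoint M}. M \<subseteq> N \<longrightarrow> M = N)"
    by (rule bexE)
  from M_in have M: "M \<subseteq> ?C" "disjoint M"
    by simp_all
  have max: "N = M" if "N \<subseteq> ?C" "disjoint N" "M \<subseteq> N" for N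
    using bspec[OF conjunct2[OF M_max], of N] that by simp
  let ?Q' = "?R\<lparr>arcs := arcs ?R - \<Union>M\<rparr>"
  have "\<not> two_cycle ?Q' a b" for a b
  proof
    assume *: "two_cycle ?Q' a b"
    then have **: "a \<notin> \<Union>M" "b \<notin> \<Union>M" "two_cycle ?R a b"
      by (auto simp: two_cycle_def)
    then have "insert {a, b} M = M"
      using M by (intro max) (auto simp: pairwise_insert disjnt_def)
    with ** show False
      by blast
  qed
  with M show ?thesis
    unfolding is_mutation_def by blast
qed

lemma is_mutation_cluster_quiver:
  assumes "cluster_quiver Q" "is_mutation Q k Q'"
  shows "cluster_quiver Q'"
proof -
  interpret cluster_quiver Q by fact
  note finite_arcs_premutation[OF fin_digraph_axioms, of k]
  moreover have "cluster_quiver Q' \<longleftrightarrow>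
      finite (verts Q') \<and> finite (arcs Q') \<and>
      (\<forall>e\<in>arcs Q'. tail Q' e \<in> verts Q' \<and> head Q' e \<in> verts Q' \<and> tail Q' e \<noteq> head Q' e) \<and>
      (\<forall>a b. \<not> two_cycle Q' a b)"
    by (auto simp: cluster_quiver_def cluster_quiver_axioms_def fin_digraph_def
        fin_digraph_axioms_def loopfree_digraph_def loopfree_digraph_axioms_def wf_digraph_def)
  moreover have "tail Q a \<noteq> head Q b" if "(a, b) \<in> paths_through Q k" for a b
    using that no_two_cycles[of a b]
    by (auto simp: paths_through_def composable_pairs_def two_cycle_def)
  then have "mut_tail Q e \<in> verts Q \<and> mut_head Q e \<in> verts Q \<and> mut_tail Q e \<noteq> mut_head Q e"
    if "e \<in> arcs (premutation Q k)" for e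
    using that no_loops
    by (auto simp: premutation_def paths_through_def composable_pairs_def dest: sym)
  moreover have "verts Q' = verts Q" "tail Q' = mut_tail Q" "head Q' = mut_head Q"
    "arcs Q' \<subseteq> arcs (premutation Q k)" "\<forall>a b. \<not> two_cycle Q' a b"
    using assms(2) by (auto simp: is_mutation_def premutation_def)
  ultimately show ?thesis
    by (simp add: finite_subset subset_iff)
qed

lemma Rev_not_cancelled:
  assumes "cluster_quiver Q" "is_mutation Q k Q'" "a \<in> arcs Q" "tail Q a = k \<or> head Q a = k"
  shows "Rev a \<in> arcs Q'"
proof -
  interpret cluster_quiver Q by fact
  let ?R = "premutation Q k"
  have no_cycle: "\<not> two_cycle ?R (Rev a) x" for x
  proof (cases x)
    case (Init b)
    then show ?thesis
      using assms(4) by (auto simp: two_cycle_def premutation_def)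
  next
    case (Comp b c)
    then show ?thesis
      using assms(4) no_loops[of b] no_loops[of c]
      by (auto simp: two_cycle_def premutation_def paths_through_def composable_pairs_def)
  next
    case (Rev b)
    then show ?thesis
      using no_two_cycles[of b a] by (auto simp: two_cycle_def premutation_def)
  qed
  have "\<not> two_cycle ?R x (Rev a)" for x
    using no_cycle[of x] by (auto simp: two_cycle_def)
  with no_cycle have "Rev a \<notin> \<Union>M" if "M \<subseteq> {{a, b} |a b. two_cycle ?R a b}" for M
    using that by fastforce
  moreover have "Rev a \<in> arcs ?R"
    using assms(3,4) by (auto simp: premutation_def)
  ultimately show ?thesis
    using assms(2) by (auto simp: is_mutation_def)
qed

lemma forced_relations_subset:
  assumes "cluster_quiver Q" "is_mutation Q k Q'"
  shows "forced_relations Q I k Q' \<subseteq> composable_pairs Q'"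
proof -
  have "tail Q' = mut_tail Q" "head Q' = mut_head Q"
    using assms(2) by (auto simp: is_mutation_def premutation_def)
  then show ?thesis
    using Rev_not_cancelled[OF assms]
    by (auto simp: forced_relations_def composable_pairs_def paths_through_def)
qed

end

theory Submission
  imports Defs
begin

text \<open>
  The mutated quiver is again finite, and over every finite quiver the ideal generated by all
  composable pairs outside an acyclic relation \<open>P\<close> is admissible. It lies in the square of the
  arrow ideal because its generators are products of two arrows. For the other inclusion, the
  \<open>m\<close>-th power of the arrow ideal is contained in the linear span of the paths of length at least
  \<open>m\<close>. Consecutive arrows of a path are composable, so a path that avoids all generators steps from
  each arrow to the next along \<open>P\<close>. By acyclicity such a path never repeats an arrow, hence is not
  longer than the number of arrows. Every longer path therefore factors through a generator.
\<close>

section \<open>The length filtration of the path algebra\<close>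

definition long_paths_span ::
  "('v, 'e) pre_digraph \<Rightarrow> nat \<Rightarrow> (('v, 'e) path \<Rightarrow>\<^sub>0 'f::field) set"
where
  "long_paths_span Q n =
     {x. Poly_Mapping.keys x \<subseteq> {p \<in> paths Q. n \<le> length (snd p)}}"

lemma long_paths_span_subset_carrier: "long_paths_span Q n \<subseteq> carrier (path_algebra Q)"
  by (auto simp: long_paths_span_def path_algebra_def)

lemma carrier_eq_long_paths_span: "carrier (path_algebra Q) = long_paths_span Q 0"
  by (auto simp: long_paths_span_def path_algebra_def)

lemma long_paths_span_add:
  assumes "x \<in> long_paths_span Q n" "y \<in> long_paths_span Q n"
  shows "x + y \<in> long_paths_span Q n"
  using assms Poly_Mapping.keys_add[of x y] unfolding long_paths_span_def by blast

text \<open>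
  Lengths add up under concatenation, so these spans filter the path algebra. In particular, as the
  zeroth one is the whole algebra, each of them is an ideal.
\<close>

lemma path_mult_long_paths_span:
  assumes "wf_digraph Q" "x \<in> long_paths_span Q m" "y \<in> long_paths_span Q n"
  shows "path_mult Q x y \<in> long_paths_span Q (m + n)"
proof -
  have x: "p \<in> paths Q" "m \<le> length (snd p)" if "p \<in> Poly_Mapping.keys x" for p
    using assms(2) that by (auto simp: long_paths_span_def)
  have y: "q \<in> paths Q" "n \<le> length (snd q)" if "q \<in> Poly_Mapping.keys y" for q
    using assms(3) that by (auto simp: long_paths_span_def)
  have "(fst q, snd q @ snd p) \<in> paths Q \<and> m + n \<le> length (snd q @ snd p)"
    if "p \<in> Poly_Mapping.keys x" "q \<in> Poly_Mapping.keys y" "path_end Q q = fst p" for p q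
    using paths_append[OF assms(1) x(1) y(1)] x(2) y(2) that by (simp add: add.commute add_mono)
  then have "Poly_Mapping.keys (path_mult Q x y) \<subseteq> {p \<in> paths Q. m + n \<le> length (snd p)}"
    unfolding path_mult_def by (intro order.trans[OF Poly_Mapping.keys_sum] UN_least) simp
  then show ?thesis
    by (simp add: long_paths_span_def)
qed

lemma long_paths_span_ideal:
  fixes Q :: "('v, 'e) pre_digraph"
  assumes "fin_digraph Q"
  shows "ideal (long_paths_span Q n) (path_algebra Q :: (('v, 'e) path \<Rightarrow>\<^sub>0 'f::field) ring)"
proof -
  interpret fin_digraph Q by fact
  interpret A: ring "path_algebra Q :: (('v, 'e) path \<Rightarrow>\<^sub>0 'f) ring"
    by (rule ring_path_algebra) fact
  note mult_closed = path_mult_long_paths_span[OF wf_digraph_axioms]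
  have minus_closed: "\<ominus>\<^bsub>path_algebra Q\<^esub> x \<in> long_paths_span Q n"
    if "x \<in> long_paths_span Q n" for x :: "('v, 'e) path \<Rightarrow>\<^sub>0 'f"
  proof -
    have "- x \<in> long_paths_span Q n"
      using that by (simp add: long_paths_span_def)
    moreover from this have "\<ominus>\<^bsub>path_algebra Q\<^esub> x = - x"
      using that long_paths_span_subset_carrier[of Q n]
      by (intro A.minus_equality) (auto simp: path_algebra_def)
    ultimately show ?thesis
      by simp
  qed
  show ?thesis
  proof (rule idealI[OF A.ring_axioms])
    show "subgroup (long_paths_span Q n)
        (add_monoid (path_algebra Q :: (('v, 'e) path \<Rightarrow>\<^sub>0 'f) ring))"
    proof (rule A.add.subgroupI)
      show "long_paths_span Q n \<noteq> ({} :: (('v, 'e) path \<Rightarrow>\<^sub>0 'f) set)"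
        by (auto simp: long_paths_span_def intro!: exI[of _ 0])
    qed (use minus_closed long_paths_span_add[of _ Q n] long_paths_span_subset_carrier[of Q n]
      in \<open>auto simp: path_algebra_def a_inv_def\<close>)
  next
    fix a x :: "('v, 'e) path \<Rightarrow>\<^sub>0 'f"
    assume a: "a \<in> long_paths_span Q n" and x: "x \<in> carrier (path_algebra Q)"
    show "x \<otimes>\<^bsub>path_algebra Q\<^esub> a \<in> long_paths_span Q n"
      using mult_closed[of x 0 a n] a x
      by (simp add: carrier_eq_long_paths_span) (simp add: path_algebra_def)
    show "a \<otimes>\<^bsub>path_algebra Q\<^esub> x \<in> long_paths_span Q n"
      using mult_closed[of a n x 0] a x
      by (simp add: carrier_eq_long_paths_span) (simp add: path_algebra_def)
  qed
qed

text \<open>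
  Ideals are closed under scaling, since scaling a path is multiplication by a scaled trivial path.
  Hence it suffices to look at the paths themselves.
\<close>

lemma long_paths_span_subset_ideal:
  fixes Q :: "('v, 'e) pre_digraph" and J :: "(('v, 'e) path \<Rightarrow>\<^sub>0 'f::field) set"
  assumes "wf_digraph Q" and "ideal J (path_algebra Q)"
    and long: "\<And>p. p \<in> paths Q \<Longrightarrow> n \<le> length (snd p) \<Longrightarrow> Poly_Mapping.single p 1 \<in> J"
  shows "long_paths_span Q n \<subseteq> J"
proof
  interpret wf_digraph Q by fact
  interpret ideal J "path_algebra Q" by fact
  note subgroup = additive_subgroup_axioms
  fix x :: "('v, 'e) path \<Rightarrow>\<^sub>0 'f"
  assume "x \<in> long_paths_span Q n"
  then have x: "p \<in> paths Q" "n \<le> length (snd p)" if "p \<in> Poly_Mapping.keys x" for p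
    using that by (auto simp: long_paths_span_def)
  have single: "Poly_Mapping.single p c \<in> J" if "p \<in> Poly_Mapping.keys x" for p c
  proof -
    have "fst p \<in> verts Q"
      using x(1)[OF that] by (auto simp: paths_def)
    then have "Poly_Mapping.single (fst p, []) c \<in> carrier (path_algebra Q)"
      by (auto simp: path_algebra_def paths_def awalk_Nil_iff)
    then have "Poly_Mapping.single p 1 \<otimes>\<^bsub>path_algebra Q\<^esub> Poly_Mapping.single (fst p, []) c \<in> J"
      using long[OF x[OF that]] by (rule I_r_closed[rotated])
    then show ?thesis
      by (simp add: path_algebra_def path_mult_single path_end_alt)
  qed
  have "(\<Sum>p\<in>A. Poly_Mapping.single p (Poly_Mapping.lookup x p)) \<in> J"
    if "finite A" "A \<subseteq> Poly_Mapping.keys x" for A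
    using that
  proof (induction A)
    case empty
    then show ?case
      using additive_subgroup.zero_closed[OF subgroup] by (simp add: path_algebra_def)
  next
    case (insert p A)
    then show ?case
      using additive_subgroup.a_closed[OF subgroup single] by (simp add: path_algebra_def)
  qed
  then show "x \<in> J"
    by (subst sum_single_eq) simp
qed


section \<open>Powers of the arrow ideal\<close>

lemma arrow_in_long_paths_span:
  assumes "wf_digraph Q" "a \<in> arcs Q"
  shows "arrow Q a \<in> long_paths_span Q 1"
proof -
  interpret wf_digraph Q by fact
  show ?thesis
    using assms(2) by (auto simp: arrow_def long_paths_span_def paths_def
        awalk_Cons_iff awalk_Nil_iff)
qed

lemma arrow_ideal_subset_long_paths_span:
  assumes "fin_digraph Q"
  shows "arrow_ideal Q \<subseteq> long_paths_span Q 1"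
proof -
  interpret fin_digraph Q by fact
  show ?thesis
    unfolding arrow_ideal_def
    using arrow_in_long_paths_span[OF wf_digraph_axioms]
    by (intro ring.genideal_minimal ring_path_algebra long_paths_span_ideal assms) blast
qed

lemma arrow_ideal_power_subset_long_paths_span:
  fixes Q :: "('v, 'e) pre_digraph"
  assumes "fin_digraph Q"
  shows "(arrow_ideal Q :: (('v, 'e) path \<Rightarrow>\<^sub>0 'f::field) set)
    [^]\<^bsub>ideals_set (path_algebra Q)\<^esub> n \<subseteq> long_paths_span Q n"
proof (induction n)
  case 0
  show ?case
    by (simp add: nat_pow_def ideals_set_def carrier_eq_long_paths_span)
next
  case (Suc n)
  interpret fin_digraph Q by fact
  show ?case
  proof
    fix x :: "('v, 'e) path \<Rightarrow>\<^sub>0 'f"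
    assume "x \<in> arrow_ideal Q [^]\<^bsub>ideals_set (path_algebra Q)\<^esub> Suc n"
    then have "x \<in> ideal_prod (path_algebra Q)
        (arrow_ideal Q [^]\<^bsub>ideals_set (path_algebra Q)\<^esub> n) (arrow_ideal Q)"
      by (simp add: nat_pow_def ideals_set_def)
    then show "x \<in> long_paths_span Q (Suc n)"
    proof induction
      case (prod i j)
      then have "path_mult Q i j \<in> long_paths_span Q (n + 1)"
        using Suc.IH arrow_ideal_subset_long_paths_span[OF assms]
        by (intro path_mult_long_paths_span[OF wf_digraph_axioms]) auto
      then show ?case
        by (simp add: path_algebra_def)
    next
      case (sum x y)
      then show ?case
        using long_paths_span_add[of x Q "Suc n" y] by (simp add: path_algebra_def)
    qed
  qed
qed

lemma pair_ideal_subset_arrow_ideal_square: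
  fixes Q :: "('v, 'e) pre_digraph"
  assumes "fin_digraph Q" "Z \<subseteq> composable_pairs Q"
  shows "(pair_ideal Q Z :: (('v, 'e) path \<Rightarrow>\<^sub>0 'f::field) set)
    \<subseteq> arrow_ideal Q [^]\<^bsub>ideals_set (path_algebra Q)\<^esub> (2::nat)"
proof -
  let ?R = "path_algebra Q :: (('v, 'e) path \<Rightarrow>\<^sub>0 'f) ring"
  interpret fin_digraph Q by fact
  interpret A: ring ?R
    by (rule ring_path_algebra) fact
  have carr: "arrow Q a \<in> carrier ?R" if "a \<in> arcs Q" for a
    using arrow_in_long_paths_span[OF wf_digraph_axioms that] long_paths_span_subset_carrier
    by blast
  then have sub: "arrow Q ` arcs Q \<subseteq> carrier ?R"
    by blast
  then have ideal: "ideal (arrow_ideal Q) ?R"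
    unfolding arrow_ideal_def by (rule A.genideal_ideal)
  have arrow: "arrow Q a \<in> (arrow_ideal Q :: (('v, 'e) path \<Rightarrow>\<^sub>0 'f) set)" if "a \<in> arcs Q" for a
    using A.genideal_self[OF sub] that unfolding arrow_ideal_def by blast
  \<comment> \<open>Powers are built up from the unit ideal, the whole algebra, so the square has the
    whole algebra as an extra factor, which is fed with the identity below.\<close>
  have square: "arrow_ideal Q [^]\<^bsub>ideals_set ?R\<^esub> (2::nat) =
      ideal_prod ?R (ideal_prod ?R (carrier ?R) (arrow_ideal Q)) (arrow_ideal Q)"
    by (simp add: nat_pow_def ideals_set_def numeral_2_eq_2)
  have "pair_path Q z \<in> arrow_ideal Q [^]\<^bsub>ideals_set ?R\<^esub> (2::nat)" if "z \<in> Z" for z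
  proof -
    have "z \<in> composable_pairs Q"
      using that assms(2) by blast
    then obtain a b where z: "z = (a, b)" "a \<in> arcs Q" "b \<in> arcs Q"
      by (auto simp: composable_pairs_def)
    have "\<one>\<^bsub>?R\<^esub> \<otimes>\<^bsub>?R\<^esub> arrow Q b \<in> ideal_prod ?R (carrier ?R) (arrow_ideal Q)"
      using arrow z by (intro ideal_prod.prod) auto
    then show ?thesis
      using arrow carr z
      by (auto simp: square pair_path_def intro!: ideal_prod.prod)
  qed
  moreover have "ideal (arrow_ideal Q [^]\<^bsub>ideals_set ?R\<^esub> (2::nat)) ?R"
    unfolding square by (intro A.ideal_prod_is_ideal A.oneideal ideal)
  ultimately show ?thesis
    unfolding pair_ideal_def by (intro A.genideal_minimal) auto
qed


section \<open>Long paths factor through a generator\<close>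

lemma pair_path_in_carrier:
  assumes "wf_digraph Q" "z \<in> composable_pairs Q"
  shows "pair_path Q z \<in> carrier (path_algebra Q)"
proof -
  interpret wf_digraph Q by fact
  obtain a b where z: "z = (a, b)"
    by (cases z)
  then have "awalk (tail Q a) [a, b] (head Q b)"
    using assms(2) by (simp add: composable_pairs_def awalk_Cons_iff awalk_Nil_iff)
  then have "(tail Q a, [a, b]) \<in> paths Q"
    by (auto simp: paths_def simp del: awalk_Cons_iff)
  then show ?thesis
    using assms(2) by (simp add: z pair_path_eq path_algebra_def)
qed

lemma pair_ideal_ideal:
  assumes "fin_digraph Q" "Z \<subseteq> composable_pairs Q"
  shows "ideal (pair_ideal Q Z) (path_algebra Q)"
proof -
  interpret fin_digraph Q by fact
  show ?thesis
    unfolding pair_ideal_def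
    using pair_path_in_carrier[OF wf_digraph_axioms] assms
    by (intro ring.genideal_ideal ring_path_algebra) auto
qed

lemma path_factoring_through_pair_in_pair_ideal:
  fixes Q :: "('v, 'e) pre_digraph"
  assumes "fin_digraph Q" "Z \<subseteq> composable_pairs Q" "(a, b) \<in> Z"
    and path: "(u, as @ a # b # bs) \<in> paths Q"
  shows "Poly_Mapping.single (u, as @ a # b # bs) 1 \<in>
    (pair_ideal Q Z :: (('v, 'e) path \<Rightarrow>\<^sub>0 'f::field) set)"
proof -
  let ?R = "path_algebra Q :: (('v, 'e) path \<Rightarrow>\<^sub>0 'f) ring"
  interpret fin_digraph Q by fact
  interpret ideal "pair_ideal Q Z" ?R
    using assms(1,2) by (rule pair_ideal_ideal)
  have ab: "(a, b) \<in> composable_pairs Q"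
    using assms by blast
  have "pair_path Q ` Z \<subseteq> carrier ?R"
    using pair_path_in_carrier[OF wf_digraph_axioms] assms(2) by blast
  then have "pair_path Q (a, b) \<in> (pair_ideal Q Z :: (('v, 'e) path \<Rightarrow>\<^sub>0 'f) set)"
    unfolding pair_ideal_def using assms(3) genideal_self by blast
  then have gen: "Poly_Mapping.single (tail Q a, [a, b]) 1 \<in>
      (pair_ideal Q Z :: (('v, 'e) path \<Rightarrow>\<^sub>0 'f) set)"
    by (simp add: pair_path_eq[OF ab])
  obtain v where walk: "awalk u (as @ a # b # bs) v"
    using path by (auto simp: paths_def)
  then have as: "awalk u as (tail Q a)" and bs: "awalk (head Q b) bs v"
    by (auto simp: awalk_Cons_iff)
  have end_as: "path_end Q (u, as) = tail Q a"
    using as by (auto simp: path_end_def)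
  have as_carr: "Poly_Mapping.single (u, as) 1 \<in> carrier ?R"
    and bs_carr: "Poly_Mapping.single (head Q b, bs) 1 \<in> carrier ?R"
    using as bs by (auto simp: path_algebra_def paths_def)
  have "Poly_Mapping.single (head Q b, bs) 1 \<otimes>\<^bsub>?R\<^esub>
      (Poly_Mapping.single (tail Q a, [a, b]) 1 \<otimes>\<^bsub>?R\<^esub> Poly_Mapping.single (u, as) 1)
      \<in> pair_ideal Q Z"
    by (intro I_l_closed I_r_closed gen as_carr bs_carr)
  then show ?thesis
    by (simp add: path_algebra_def path_mult_single end_as) (simp add: path_end_alt)
qed

text \<open>
  A repeated arrow would be related to itself by the transitive closure, along the part of the list
  between its two occurrences.
\<close>

lemma distinct_if_successively_acyclic:
  assumes "acyclic P" "successively (\<lambda>a b. (a, b) \<in> P) xs"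
  shows "distinct xs"
proof -
  have "successively (\<lambda>a b. (a, b) \<in> P\<^sup>+) xs"
    using assms(2) by (rule successively_mono) auto
  then have "sorted_wrt (\<lambda>a b. (a, b) \<in> P\<^sup>+) xs"
    using successively_conv_sorted_wrt[of "\<lambda>a b. (a, b) \<in> P\<^sup>+" xs]
    by (blast intro: transpI trancl_trans)
  then show ?thesis
    using assms(1) by (induction xs) (auto simp: acyclic_def)
qed

lemma not_successivelyE:
  assumes "\<not> successively R xs"
  obtains as a b bs where "xs = as @ a # b # bs" "\<not> R a b"
  using assms
proof (induction xs arbitrary: thesis rule: induct_list012)
  case (3 x y zs)
  show ?case
  proof (cases "R x y")
    case True
    then have "\<not> successively R (y # zs)"
      using "3.prems"(2) by simp
    then obtain as a b bs where "y # zs = as @ a # b # bs" "\<not> R a b"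
      using "3.IH"(2) by blast
    then show ?thesis
      by (intro "3.prems"(1)[of "x # as"]) auto
  next
    case False
    then show ?thesis
      by (intro "3.prems"(1)[of "[]"]) auto
  qed
qed auto

theorem admissible_pair_ideal_outside_acyclic:
  fixes Q :: "('v, 'e) pre_digraph"
  assumes "fin_digraph Q" "acyclic P"
  shows "admissible Q
    (pair_ideal Q (composable_pairs Q - P) :: (('v, 'e) path \<Rightarrow>\<^sub>0 'f::field) set)"
proof -
  interpret fin_digraph Q by fact
  let ?Z = "composable_pairs Q - P"
  let ?I = "pair_ideal Q ?Z :: (('v, 'e) path \<Rightarrow>\<^sub>0 'f) set"
  \<comment> \<open>A path longer than the number of arrows repeats an arrow; adding two instead of one keeps the
    exponent at least two even if there are no arrows at all.\<close>
  let ?m = "card (arcs Q) + 2"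
  have ideal: "ideal ?I (path_algebra Q)"
    by (rule pair_ideal_ideal[OF assms(1)]) blast
  have "Poly_Mapping.single p 1 \<in> ?I" if p: "p \<in> paths Q" "?m \<le> length (snd p)" for p
  proof -
    obtain u xs where p_eq: "p = (u, xs)"
      by (cases p)
    obtain v where walk: "awalk u xs v"
      using p by (auto simp: p_eq paths_def)
    then have "card (set xs) \<le> card (arcs Q)"
      by (intro card_mono) auto
    then have "\<not> distinct xs"
      using p(2) by (auto simp: p_eq dest: distinct_card)
    then have "\<not> successively (\<lambda>a b. (a, b) \<in> P) xs"
      using distinct_if_successively_acyclic[OF assms(2)] by blast
    then obtain as a b bs where xs: "xs = as @ a # b # bs" "(a, b) \<notin> P"
      by (rule not_successivelyE)
    have "(a, b) \<in> ?Z"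
      using walk xs by (auto simp: composable_pairs_def awalk_Cons_iff)
    then have "Poly_Mapping.single (u, as @ a # b # bs) 1 \<in> ?I"
      using p(1) unfolding p_eq xs(1)
      by (rule path_factoring_through_pair_in_pair_ideal[OF assms(1) Diff_subset])
    then show ?thesis
      by (simp only: p_eq xs(1))
  qed
  then have "long_paths_span Q ?m \<subseteq> ?I"
    by (intro long_paths_span_subset_ideal[OF wf_digraph_axioms ideal])
  then have "arrow_ideal Q [^]\<^bsub>ideals_set (path_algebra Q)\<^esub> ?m \<subseteq> ?I"
    using arrow_ideal_power_subset_long_paths_span[OF assms(1)] by blast
  moreover have "?I \<subseteq> arrow_ideal Q [^]\<^bsub>ideals_set (path_algebra Q)\<^esub> (2::nat)"
    by (rule pair_ideal_subset_arrow_ideal_square[OF assms(1)]) blast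
  ultimately show ?thesis
    unfolding admissible_def using ideal by (intro conjI exI[of _ ?m]) simp_all
qed

theorem proposition4p2:
  fixes Q :: "('v, 'e) pre_digraph"
    and I :: "(('v, 'e) path \<Rightarrow>\<^sub>0 'f::field_char_0) set"
    and Z :: "('e \<times> 'e) set"
    and k :: 'v
    and Q' :: "('v, 'e mut_arrow) pre_digraph"
    and P_pref P Z' :: "('e mut_arrow \<times> 'e mut_arrow) set"
    and I' :: "(('v, 'e mut_arrow) path \<Rightarrow>\<^sub>0 'f) set"
  assumes "cluster_quiver Q"
    and "gentle Q I"
    and "Z \<subseteq> composable_pairs Q" and "I = pair_ideal Q Z"
    and "k \<in> verts Q"
    and "is_mutation Q k Q'"
    and "P_pref \<subseteq> composable_pairs Q' - forced_relations Q I k Q'"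
    and "P \<subseteq> P_pref"
    and "acyclic P"
    and "Z' = composable_pairs Q' - P"
    and "I' = pair_ideal Q' Z'"
  shows "admissible Q' I'"
proof -
  have "cluster_quiver Q'"
    using assms(1,6) by (rule is_mutation_cluster_quiver)
  then have "fin_digraph Q'"
    by (simp add: cluster_quiver_def)
  then show ?thesis
    using admissible_pair_ideal_outside_acyclic assms(9-11) by blast
qed

end
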